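(* Let $r$ and $s$ be positive integers and let $G,F_1,\dots,F_s$ be graphs such that $G\xrightarrow{r}\{F_1,\dots,F_s\}$. Let $H$ be a graph and, for each $i\in\{1,\dots,s\}$, let $(a_i,b_i)$ be a pair of adjacent vertices of $F_i$. Suppose there is a positive integer $k$ such that, for every $i\in\{1,\dots,s\}$, a copy of $H$ is a subgraph of $L_k(F_i,a_i,b_i)$. Then there exists a positive integer $n$ such that $G^{\square n}\xrightarrow{r}H$.
   Context: Graphs are finite and simple. The Cartesian product $G\square H$ of graphs $G,H$ has vertex set $V(G)\times V(H)$, and $(x_1,x_2),(y_1,y_2)$ are adjacent iff either $x_1y_1\in E(G)$ and $x_2=y_2$, or $x_1=y_1$ and $x_2y_2\in E(H)$. The $n$-th Cartesian power is $G^{\square 1}=G$, $G^{\square n}=G^{\square (n-1)}\square G$ for $n\ge 2$. For a positive integer $r$ and graphs $G,H_1,\dots,H_p$, $G\xrightarrow{r}\{H_1,\dots,H_p\}$ means that every coloring of the vertices of $G$ with $r$ colors contains, for some $i$, a monochromatic (all vertices of the same color), not necessarily induced, subgraph isomorphic to $H_i$; $G\xrightarrow{r}H$ means $G\xrightarrow{r}\{H\}$. A copy of $H$ is a graph isomorphic to $H$. Definition of $L_k(F,a,b)$. Let $Q_{2k-1}=K_2^{\square(2k-1)}$ be the hypercube on $\{0,1\}^{2k-1}$, let $V_j$ be the set of its vertices with exactly $j$ ones, and let $L_k$ be the subgraph of $Q_{2k-1}$ induced by $V_{k-1}\cup V_k$. Represent each edge $e=uv$ of $Q_{2k-1}$ by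 the vector that agrees with $u$ and $v$ in the $2k-2$ positions in which they agree and has the symbol $*$ in the position in which they differ. Let $E^*\subseteq E(L_k)$ be the set of edges of $L_k$ whose representation has no ones after (to the right of) the star; thus $E^*$ consists of exactly one edge for each $u\in V_k$, namely the edge joining $u$ to the vertex obtained from $u$ by changing its last (rightmost) one to zero. For a graph $F$ and a pair $(a,b)$ of adjacent vertices of $F$, let $F_e$ ($e\in E^*$) be copies of $F$ such that for each $e\in E^*$ the vertex of $F_e$ corresponding to $a$ is the endpoint of $e$ in $V_k$, the vertex of $F_e$ corresponding to $b$ is the endpoint of $e$ in $V_{k-1}$, and every other vertex of $F_e$ belongs neither to $V(L_k)$ nor to $V(F_{e'})$ for any $e'\in E^*\setminus\{e\}$. Then $L_k(F,a,b)=L_k\cup\bigcup_{e\in E^*}F_e$. *)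

theory Defs
  imports "Graph_Theory.Graph_Theory"
begin

text \<open>
  A finite simple graph is a \<open>pair_graph\<close>: a finite vertex set with a symmetric, irreflexive set of
  ordered pairs; an undirected edge \<open>uv\<close> is present as both \<open>(u, v)\<close> and \<open>(v, u)\<close>.
  Between such graphs \<open>subgraph\<close> and \<open>digraph_iso\<close> are the usual notions for undirected graphs: in
  a \<open>with_proj\<close> digraph the map on arcs is forced by the map on vertices.
\<close>

definition relabel :: "('a \<Rightarrow> 'b) \<Rightarrow> 'a pair_pre_digraph \<Rightarrow> 'b pair_pre_digraph" where
  "relabel f G = \<lparr> pverts = f ` pverts G, parcs = map_prod f f ` parcs G \<rparr>"

definition induced :: "'a pair_pre_digraph \<Rightarrow> 'a set \<Rightarrow> 'a pair_pre_digraph" where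
  "induced G S = \<lparr> pverts = S, parcs = {(u, v) \<in> parcs G. u \<in> S \<and> v \<in> S} \<rparr>"

definition graph_Union :: "'a pair_pre_digraph set \<Rightarrow> 'a pair_pre_digraph" where
  "graph_Union Gs = \<lparr> pverts = (\<Union>G\<in>Gs. pverts G), parcs = (\<Union>G\<in>Gs. parcs G) \<rparr>"

definition contains_copy :: "'a pair_pre_digraph \<Rightarrow> 'b pair_pre_digraph \<Rightarrow> bool" where
  "contains_copy G H \<longleftrightarrow>
    (\<exists>M :: 'a pair_pre_digraph.
      subgraph (with_proj M) (with_proj G) \<and> digraph_iso (with_proj H) (with_proj M))"

definition arrows :: "'a pair_pre_digraph \<Rightarrow> nat \<Rightarrow> 'b pair_pre_digraph set \<Rightarrow> bool" where
  "arrows G r Hs \<longleftrightarrow>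
    (\<forall>c :: 'a \<Rightarrow> nat. c ` pverts G \<subseteq> {1..r} \<longrightarrow>
      (\<exists>H\<in>Hs. \<exists>M :: 'a pair_pre_digraph.
        subgraph (with_proj M) (with_proj G) \<and> digraph_iso (with_proj H) (with_proj M) \<and>
        (\<forall>x\<in>pverts M. \<forall>y\<in>pverts M. c x = c y)))"

definition cart_prod ::
    "'a pair_pre_digraph \<Rightarrow> 'b pair_pre_digraph \<Rightarrow> ('a \<times> 'b) pair_pre_digraph" where
  "cart_prod G H =
    \<lparr> pverts = pverts G \<times> pverts H,
      parcs = {((x1, x2), (y1, y2)).
        x1 \<in> pverts G \<and> y1 \<in> pverts G \<and> x2 \<in> pverts H \<and> y2 \<in> pverts H \<and>
        ((x1, y1) \<in> parcs G \<and> x2 = y2 \<or> x1 = y1 \<and> (x2, y2) \<in> parcs H)} \<rparr>"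

text \<open>
  The nested pairs of an iterated product are flattened to lists, so that all powers have vertices
  of the same type. The zeroth power is the one-vertex graph; the first power is \<open>G\<close> with each
  vertex \<open>x\<close> renamed to \<open>[x]\<close>.
\<close>

primrec cart_power :: "'a pair_pre_digraph \<Rightarrow> nat \<Rightarrow> 'a list pair_pre_digraph" where
  "cart_power G 0 = \<lparr> pverts = {[]}, parcs = {} \<rparr>"
| "cart_power G (Suc n) = relabel (\<lambda>(xs, x). xs @ [x]) (cart_prod (cart_power G n) G)"

definition K2 :: "bool pair_pre_digraph" where
  "K2 = \<lparr> pverts = UNIV, parcs = {(x, y). x \<noteq> y} \<rparr>"

text \<open>A 0/1-vector is a Boolean list, with \<open>True\<close> for one.\<close>

definition hypercube :: "nat \<Rightarrow> bool list pair_pre_digraph" where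
  "hypercube m = cart_power K2 m"

definition layer :: "nat \<Rightarrow> nat \<Rightarrow> bool list set" where
  "layer m j = {x \<in> pverts (hypercube m). count_list x True = j}"

definition middle_layers :: "nat \<Rightarrow> bool list pair_pre_digraph" where
  "middle_layers k =
    induced (hypercube (2 * k - 1)) (layer (2 * k - 1) (k - 1) \<union> layer (2 * k - 1) k)"

text \<open>In the vector representing an edge, \<open>None\<close> is the star.\<close>

definition edge_rep :: "bool list \<Rightarrow> bool list \<Rightarrow> bool option list" where
  "edge_rep u v = map2 (\<lambda>x y. if x = y then Some x else None) u v"

definition no_ones_after_star :: "bool option list \<Rightarrow> bool" where
  "no_ones_after_star w \<longleftrightarrow>
    (\<forall>i j. i < j \<and> j < length w \<and> w ! i = None \<longrightarrow> w ! j \<noteq> Some True)"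

text \<open>Each undirected edge occurs once, oriented from layer \<open>k\<close> to layer \<open>k - 1\<close>.\<close>

definition star_edges :: "nat \<Rightarrow> (bool list \<times> bool list) set" where
  "star_edges k =
    {(u, v) \<in> parcs (middle_layers k).
      u \<in> layer (2 * k - 1) k \<and> v \<in> layer (2 * k - 1) (k - 1) \<and>
      no_ones_after_star (edge_rep u v)}"

text \<open>
  The vertices of the middle layers are tagged \<open>Inl\<close>; a vertex \<open>x\<close> of \<open>F\<close> other than \<open>a\<close> and \<open>b\<close>
  gives the private vertex \<open>Inr (e, x)\<close> of the copy attached along \<open>e\<close>.
\<close>

fun attach ::
    "'f \<Rightarrow> 'f \<Rightarrow> bool list \<times> bool list \<Rightarrow> 'f \<Rightarrow> bool list + (bool list \<times> bool list) \<times> 'f" where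
  "attach a b (u, v) x = (if x = a then Inl u else if x = b then Inl v else Inr ((u, v), x))"

definition attached_layers ::
    "nat \<Rightarrow> 'f pair_pre_digraph \<Rightarrow> 'f \<Rightarrow> 'f
      \<Rightarrow> (bool list + (bool list \<times> bool list) \<times> 'f) pair_pre_digraph" where
  "attached_layers k F a b =
    graph_Union (insert (relabel Inl (middle_layers k))
      ((\<lambda>e. relabel (attach a b e) F) ` star_edges k))"


lemma pair_graphI:
  assumes "finite (pverts G)" "parcs G \<subseteq> pverts G \<times> pverts G"
    and "sym (parcs G)" "irrefl (parcs G)"
  shows "pair_graph G"
proof -
  have "finite (parcs G)"
    using assms by (meson finite_SigmaI finite_subset)
  then show ?thesis
    using assms by unfold_locales (auto simp: symmetric_def irrefl_def)
qed

lemma pair_graphD: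
  assumes "pair_graph G"
  shows "finite (pverts G)" "parcs G \<subseteq> pverts G \<times> pverts G"
    and "sym (parcs G)" "irrefl (parcs G)"
proof -
  interpret pair_graph G by fact
  show "finite (pverts G)" by (rule pair_finite_verts)
  show "parcs G \<subseteq> pverts G \<times> pverts G" by (auto dest: in_arcsD1 in_arcsD2)
  show "sym (parcs G)" using arcs_symmetric by (blast intro: symI)
  show "irrefl (parcs G)" using pair_no_loops by (force simp: irrefl_def)
qed

lemma pair_graph_relabel:
  assumes "pair_graph G" "inj_on f (pverts G)"
  shows "pair_graph (relabel f G)"
proof (rule pair_graphI)
  note G = pair_graphD[OF assms(1)]
  show "finite (pverts (relabel f G))"
    "parcs (relabel f G) \<subseteq> pverts (relabel f G) \<times> pverts (relabel f G)"
    using G by (auto simp: relabel_def)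
  show "sym (parcs (relabel f G))"
    using G(3) by (auto simp: relabel_def sym_def image_iff Bex_def)
  show "irrefl (parcs (relabel f G))"
    using G(2,4) assms(2) by (fastforce simp: relabel_def irrefl_def dest: inj_onD)
qed

lemma pair_graph_cart_prod:
  assumes "pair_graph G" "pair_graph H"
  shows "pair_graph (cart_prod G H)"
proof -
  note G = pair_graphD[OF assms(1)] and H = pair_graphD[OF assms(2)]
  show ?thesis
  proof (rule pair_graphI)
    show "finite (pverts (cart_prod G H))"
      using G(1) H(1) by (simp add: cart_prod_def)
    show "parcs (cart_prod G H) \<subseteq> pverts (cart_prod G H) \<times> pverts (cart_prod G H)"
      by (auto simp: cart_prod_def)
    show "sym (parcs (cart_prod G H))"
      using G(3) H(3) unfolding sym_def cart_prod_def by simp blast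
    show "irrefl (parcs (cart_prod G H))"
      using G(4) H(4) by (auto simp: irrefl_def cart_prod_def)
  qed
qed

lemma pair_graph_cart_power:
  assumes "pair_graph G" shows "pair_graph (cart_power G n)"
proof (induction n)
  case 0
  show ?case by (rule pair_graphI) (auto simp: irrefl_def sym_def)
next
  case (Suc n)
  show ?case
    unfolding cart_power.simps
    by (intro pair_graph_relabel pair_graph_cart_prod Suc assms) (auto simp: inj_on_def)
qed

lemma pair_graph_K2: "pair_graph K2"
  by (rule pair_graphI) (auto simp: K2_def sym_def irrefl_def)

lemma pair_graph_hypercube: "pair_graph (hypercube m)"
  unfolding hypercube_def by (intro pair_graph_cart_power pair_graph_K2)

lemma pair_graph_middle_layers: "pair_graph (middle_layers k)"
proof -
  note Q = pair_graphD[OF pair_graph_hypercube[of "2 * k - 1"]]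
  show ?thesis
    using Q by (intro pair_graphI)
      (auto simp: middle_layers_def induced_def layer_def sym_def irrefl_def)
qed

lemma pair_graph_attached_layers:
  assumes "pair_graph F"
  shows "pair_graph (attached_layers k F a b)"
proof -
  let ?Gs = "insert (relabel Inl (middle_layers k)) ((\<lambda>e. relabel (attach a b e) F) ` star_edges k)"
  note L = pair_graphD[OF pair_graph_middle_layers[of k]]
  have star: "star_edges k \<subseteq> parcs (middle_layers k)"
    by (auto simp: star_edges_def)
  have "finite (star_edges k)"
    using L star by (meson finite_SigmaI finite_subset)
  then have fin: "finite ?Gs" by simp
  have "pair_graph (relabel (attach a b e) F)" if "e \<in> star_edges k" for e
  proof (rule pair_graph_relabel[OF assms])
    obtain u v where e: "e = (u, v)" by fastforce
    then have "u \<noteq> v" using that star L(4) by (auto simp: irrefl_def)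
    then show "inj_on (attach a b e) (pverts F)"
      by (auto simp: e inj_on_def split: if_splits)
  qed
  then have all: "\<forall>G\<in>?Gs. pair_graph G"
    by (auto intro!: pair_graph_relabel pair_graph_middle_layers)
  show ?thesis
    unfolding attached_layers_def
  proof (rule pair_graphI)
    show "finite (pverts (graph_Union ?Gs))"
      unfolding graph_Union_def pair_pre_digraph.simps
      using fin all pair_graphD(1) by blast
    show "parcs (graph_Union ?Gs) \<subseteq> pverts (graph_Union ?Gs) \<times> pverts (graph_Union ?Gs)"
    proof
      fix e assume "e \<in> parcs (graph_Union ?Gs)"
      then obtain G where G: "G \<in> ?Gs" "e \<in> parcs G"
        unfolding graph_Union_def pair_pre_digraph.simps by (rule UN_E)
      then have "e \<in> pverts G \<times> pverts G"
        using all pair_graphD(2) by blast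
      moreover have "pverts G \<subseteq> pverts (graph_Union ?Gs)"
        unfolding graph_Union_def pair_pre_digraph.simps using G(1) by (rule UN_upper)
      ultimately show "e \<in> pverts (graph_Union ?Gs) \<times> pverts (graph_Union ?Gs)"
        by blast
    qed
    show "sym (parcs (graph_Union ?Gs))"
    proof (rule symI)
      fix x y assume "(x, y) \<in> parcs (graph_Union ?Gs)"
      then obtain G where G: "G \<in> ?Gs" "(x, y) \<in> parcs G"
        unfolding graph_Union_def pair_pre_digraph.simps by (rule UN_E)
      then have "(y, x) \<in> parcs G"
        using all pair_graphD(3) by (meson symD)
      with G(1) show "(y, x) \<in> parcs (graph_Union ?Gs)"
        unfolding graph_Union_def pair_pre_digraph.simps by (rule UN_I)
    qed
    show "irrefl (parcs (graph_Union ?Gs))"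
    proof (rule irreflI, rule notI)
      fix x assume "(x, x) \<in> parcs (graph_Union ?Gs)"
      then obtain G where "G \<in> ?Gs" "(x, x) \<in> parcs G"
        unfolding graph_Union_def pair_pre_digraph.simps by (rule UN_E)
      then show False
        using all pair_graphD(4) by (meson irreflD)
    qed
  qed
qed

lemma with_proj_induced:
  "with_proj (induced G S) = (with_proj G) \<restriction> S"
  by (auto simp: with_proj_def induced_def induce_subgraph_def)

end

theory Submission
  imports Defs "HOL-Library.Ramsey"
begin

text \<open>
  Fix a colouring of a large power of \<open>G\<close>. A \<^emph>\<open>line\<close> of the power, where one coordinate runs through
  \<open>V(G)\<close> and the others are fixed, is a copy of \<open>G\<close>; by the arrow hypothesis it contains a monochromatic
  copy of some \<open>F\<^sub>i\<close>. Call the line \<^emph>\<open>pinned\<close> to the arc \<open>(u, v)\<close> of \<open>G\<close> if such a copy puts \<open>a\<^sub>i\<close> on \<open>u\<close> and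
  \<open>b\<^sub>i\<close> on \<open>v\<close>. Every line is pinned to some arc, but different lines may be pinned to different arcs.

  For a single arc \<open>(u, v)\<close>, Ramsey's theorem decides. To a \<open>k\<close>-set \<open>S\<close> of coordinates belongs
  the line with \<open>u\<close> on \<open>S - {max S}\<close>, a free coordinate at \<open>max S\<close>, and \<open>v\<close> elsewhere (the lemmas call its points
  \<^emph>\<open>spikes\<close>). Colour \<open>S\<close> by the colour pattern on this line and take a homogeneous set \<open>T\<close> of \<open>2k\<close>
  coordinates. If the common pattern is pinned to \<open>(u, v)\<close> through \<open>F\<^sub>i\<close>, then the spikes over \<open>T\<close>
  form a monochromatic \<open>L\<^sub>k(F\<^sub>i, a\<^sub>i, b\<^sub>i)\<close>, hence a monochromatic \<open>H\<close> (\<open>attached_layers_embed\<close>): \<open>u\<close> plays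
  the role of one and \<open>v\<close> that of zero, and an edge of \<open>E\<^sup>*\<close> has its star exactly at the last one of its
  upper end. The reason for \<open>2k\<close> coordinates, one more than \<open>L\<^sub>k\<close> has, is to see each vertex of \<open>V\<^sub>k\<^sub>-\<^sub>1\<close>
  as a spike too. If the common pattern is not pinned to \<open>(u, v)\<close>, one of these lines avoids the arc.

  So, as long as there is no monochromatic \<open>H\<close>, arcs can be excluded one after another.
  Suppose that inside every large power there is a smaller power none of whose lines is pinned to an arc of
  \<open>E\<close>. Applying the Ramsey step inside it gives a line that is not pinned to \<open>(u, v)\<close> either
  (\<open>line_avoiding_insert\<close>). To get a whole power with this property, cut the coordinates into consecutive
  blocks, each enormous compared with those after it, and shrink every block to such a line
  (\<open>avoids_Suc\<close>). What makes this work is that a block can be treated for all the contents of the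
  other blocks at once, since these are finitely many and the colour patterns may record them all. When all arcs of
  \<open>G\<close> are excluded, a single remaining line contradicts the arrow hypothesis.
\<close>

section \<open>Copies as injective homomorphisms\<close>

definition embedding :: "('a \<Rightarrow> 'b) \<Rightarrow> 'a pair_pre_digraph \<Rightarrow> 'b pair_pre_digraph \<Rightarrow> bool" where
  "embedding h H G \<longleftrightarrow> inj_on h (pverts H) \<and> h ` pverts H \<subseteq> pverts G \<and>
    (\<forall>x y. (x, y) \<in> parcs H \<longrightarrow> (h x, h y) \<in> parcs G)"

lemma embedding_comp:
  assumes "embedding f A B" "embedding g B C"
  shows "embedding (g \<circ> f) A C"
  using assms unfolding embedding_def
  by (auto intro: comp_inj_on inj_on_subset simp: image_subset_iff)

lemma wf_with_proj: "pair_graph G \<Longrightarrow> wf_digraph (with_proj G)"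
  using pair_graphD(2)[of G] by unfold_locales auto

text \<open>
  A vertex map determines the arc map of an isomorphism between graphs of this kind, so copies can be
  handled as injective vertex maps. The predicate \<open>P\<close> carries the monochromaticity condition of
  \<open>arrows\<close>.
\<close>

lemma copy_iff_embedding:
  assumes H: "pair_graph H" and G: "pair_graph G"
  shows "(\<exists>M. subgraph (with_proj M) (with_proj G) \<and> digraph_iso (with_proj H) (with_proj M) \<and> P (pverts M))
    \<longleftrightarrow> (\<exists>h. embedding h H G \<and> P (h ` pverts H))"
proof
  assume "\<exists>M. subgraph (with_proj M) (with_proj G) \<and> digraph_iso (with_proj H) (with_proj M) \<and> P (pverts M)"
  then obtain M f where sub: "pverts M \<subseteq> pverts G" "parcs M \<subseteq> parcs G"
    and iso: "pre_digraph.digraph_isomorphism (with_proj H) f"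
    and eq: "with_proj M = app_iso f (with_proj H)" and P: "P (pverts M)"
    by (auto simp: digraph_iso_def subgraph_def)
  have V: "pverts M = iso_verts f ` pverts H" and A: "parcs M = iso_arcs f ` parcs H"
    and t: "iso_tail f = fst" and h: "iso_head f = snd"
    using arg_cong[OF eq, of verts] arg_cong[OF eq, of arcs] arg_cong[OF eq, of tail]
      arg_cong[OF eq, of head]
    by (auto simp: verts_app_iso arcs_app_iso tail_app_iso head_app_iso)
  have "(iso_verts f x, iso_verts f y) = iso_arcs f (x, y)" if "(x, y) \<in> parcs H" for x y
    using iso that t h unfolding pre_digraph.digraph_isomorphism_def
    by (force simp: prod_eq_iff)
  then have "embedding (iso_verts f) H G"
    using iso V A sub unfolding embedding_def pre_digraph.digraph_isomorphism_def by force
  with P V show "\<exists>h. embedding h H G \<and> P (h ` pverts H)" by auto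
next
  assume "\<exists>h. embedding h H G \<and> P (h ` pverts H)"
  then obtain h where h: "embedding h H G" and P: "P (h ` pverts H)" by blast
  let ?M = "relabel h H"
  let ?f = "\<lparr> iso_verts = h, iso_arcs = map_prod h h, iso_head = snd, iso_tail = fst \<rparr>"
  have inj: "inj_on h (pverts H)" using h by (simp add: embedding_def)
  have "pair_graph ?M" using pair_graph_relabel[OF H inj] .
  moreover have "pverts ?M \<subseteq> pverts G" "parcs ?M \<subseteq> parcs G"
    using h by (auto simp: relabel_def embedding_def)
  ultimately have "subgraph (with_proj ?M) (with_proj G)"
    using G by (auto simp: subgraph_def wf_with_proj)
  moreover have "inj_on (map_prod h h) (parcs H)"
    using map_prod_inj_on[OF inj inj] pair_graphD(2)[OF H] by (rule inj_on_subset)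
  then have "pre_digraph.digraph_isomorphism (with_proj H) ?f"
    using inj H by (auto simp: pre_digraph.digraph_isomorphism_def wf_with_proj)
  then have "digraph_iso (with_proj H) (with_proj ?M)"
    unfolding digraph_iso_def
    by (rule_tac exI[of _ ?f]) (auto simp: app_iso_def relabel_def with_proj_def)
  ultimately show "\<exists>M. subgraph (with_proj M) (with_proj G) \<and> digraph_iso (with_proj H) (with_proj M) \<and> P (pverts M)"
    using P by (intro exI[of _ ?M]) (auto simp: relabel_def)
qed

lemma contains_copy_iff:
  assumes "pair_graph H" "pair_graph G"
  shows "contains_copy G H \<longleftrightarrow> (\<exists>h. embedding h H G)"
  using copy_iff_embedding[OF assms, of "\<lambda>_. True"] by (simp add: contains_copy_def)

lemma arrows_iff:
  assumes "\<And>H. H \<in> Hs \<Longrightarrow> pair_graph H" "pair_graph G"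
  shows "arrows G r Hs \<longleftrightarrow> (\<forall>c. c ` pverts G \<subseteq> {1..r} \<longrightarrow>
    (\<exists>H\<in>Hs. \<exists>h. embedding h H G \<and> (\<forall>x\<in>pverts H. \<forall>y\<in>pverts H. c (h x) = c (h y))))"
  unfolding arrows_def
  using copy_iff_embedding[OF assms(1) assms(2), where P = "\<lambda>X. \<forall>x\<in>X. \<forall>y\<in>X. (_ x :: nat) = _ y"]
  by (simp cong: bex_cong)

section \<open>Words, lines and the arcs of Cartesian powers\<close>

definition words :: "'a set \<Rightarrow> nat \<Rightarrow> 'a list set" where
  "words V n = {xs. set xs \<subseteq> V \<and> length xs = n}"

lemma finite_words: "finite V \<Longrightarrow> finite (words V n)"
  unfolding words_def by (rule finite_lists_length_eq)

lemma append_in_words: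
  "xs \<in> words V m \<Longrightarrow> ys \<in> words V n \<Longrightarrow> xs @ ys \<in> words V (m + n)"
  by (auto simp: words_def)

lemma pverts_cart_power: "pverts (cart_power G n) = words (pverts G) n"
proof (induction n)
  case (Suc n)
  have "words (pverts G) (Suc n) = (\<lambda>(xs, x). xs @ [x]) ` (words (pverts G) n \<times> pverts G)"
    by (auto simp: words_def image_iff length_Suc_conv_rev)
  then show ?case by (simp add: relabel_def cart_prod_def Suc)
qed (auto simp: words_def)

text \<open>The pair \<open>(p, q)\<close> stands for the line of all \<open>p @ x # q\<close>, in which \<open>x\<close> is the free letter.\<close>

definition lines :: "'a set \<Rightarrow> nat \<Rightarrow> ('a list \<times> 'a list) set" where
  "lines V n = {(p, q). set p \<subseteq> V \<and> set q \<subseteq> V \<and> Suc (length p + length q) = n}"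

lemma point_in_words: "(p, q) \<in> lines V n \<Longrightarrow> x \<in> V \<Longrightarrow> p @ x # q \<in> words V n"
  by (auto simp: lines_def words_def)

lemma parcs_cart_power:
  assumes G: "parcs G \<subseteq> pverts G \<times> pverts G"
  shows "(xs, ys) \<in> parcs (cart_power G n) \<longleftrightarrow>
    (\<exists>p q x y. (p, q) \<in> lines (pverts G) n \<and> (x, y) \<in> parcs G \<and> xs = p @ x # q \<and> ys = p @ y # q)"
    (is "_ \<longleftrightarrow> ?R n xs ys")
proof (induction n arbitrary: xs ys)
  case 0
  show ?case by (simp add: lines_def)
next
  case (Suc n)
  have "(xs, ys) \<in> parcs (cart_power G (Suc n)) \<longleftrightarrow>
    (\<exists>xs' ys' x y. xs = xs' @ [x] \<and> ys = ys' @ [y] \<and> xs' \<in> words (pverts G) n \<and> ys' \<in> words (pverts G) n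
      \<and> x \<in> pverts G \<and> y \<in> pverts G
      \<and> (?R n xs' ys' \<and> x = y \<or> xs' = ys' \<and> (x, y) \<in> parcs G))"
  proof -
    have "(xs, ys) \<in> parcs (cart_power G (Suc n)) \<longleftrightarrow>
      (\<exists>xs' ys' x y. xs = xs' @ [x] \<and> ys = ys' @ [y]
        \<and> ((xs', x), (ys', y)) \<in> parcs (cart_prod (cart_power G n) G))"
      by (auto simp: relabel_def image_iff Bex_def)
    then show ?thesis by (simp add: cart_prod_def pverts_cart_power Suc conj_ac cong: conj_cong)
  qed
  also have "\<dots> \<longleftrightarrow> ?R (Suc n) xs ys"
  proof
    assume "\<exists>xs' ys' x y. xs = xs' @ [x] \<and> ys = ys' @ [y] \<and> xs' \<in> words (pverts G) n \<and> ys' \<in> words (pverts G) n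
      \<and> x \<in> pverts G \<and> y \<in> pverts G
      \<and> (?R n xs' ys' \<and> x = y \<or> xs' = ys' \<and> (x, y) \<in> parcs G)"
    then obtain xs' ys' x y where e: "xs = xs' @ [x]" "ys = ys' @ [y]" "xs' \<in> words (pverts G) n"
        "x \<in> pverts G" and "?R n xs' ys' \<and> x = y \<or> xs' = ys' \<and> (x, y) \<in> parcs G"
      by blast
    then consider "?R n xs' ys'" "x = y" | "xs' = ys'" "(x, y) \<in> parcs G" by blast
    then show "?R (Suc n) xs ys"
    proof cases
      case 1
      then obtain p q x' y' where "(p, q) \<in> lines (pverts G) n" "(x', y') \<in> parcs G"
        "xs' = p @ x' # q" "ys' = p @ y' # q" by blast
      with 1 e show ?thesis
        by (intro exI[of _ p] exI[of _ "q @ [x]"] exI[of _ x'] exI[of _ y']) (auto simp: lines_def)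
    next
      case 2
      with e show ?thesis
        by (intro exI[of _ xs'] exI[of _ "[]"] exI[of _ x] exI[of _ y])
          (auto simp: lines_def words_def)
    qed
  next
    assume "?R (Suc n) xs ys"
    then obtain p q x y where e: "(p, q) \<in> lines (pverts G) (Suc n)" "(x, y) \<in> parcs G"
      "xs = p @ x # q" "ys = p @ y # q" by blast
    have xy: "x \<in> pverts G" "y \<in> pverts G" using G e(2) by auto
    show "\<exists>xs' ys' x y. xs = xs' @ [x] \<and> ys = ys' @ [y] \<and> xs' \<in> words (pverts G) n \<and> ys' \<in> words (pverts G) n
      \<and> x \<in> pverts G \<and> y \<in> pverts G
      \<and> (?R n xs' ys' \<and> x = y \<or> xs' = ys' \<and> (x, y) \<in> parcs G)"
    proof (cases q rule: rev_cases)
      case Nil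
      with e xy show ?thesis
        by (intro exI[of _ p] exI[of _ x] exI[of _ y]) (auto simp: lines_def words_def)
    next
      case (snoc q' z)
      with e have l: "(p, q') \<in> lines (pverts G) n" "z \<in> pverts G" by (auto simp: lines_def)
      have "?R n (p @ x # q') (p @ y # q')" using l e(2) by blast
      with l xy e(3,4) snoc show ?thesis
        by (intro exI[of _ "p @ x # q'"] exI[of _ "p @ y # q'"] exI[of _ z])
          (auto dest: point_in_words)
    qed
  qed
  finally show ?case .
qed

lemma adjacent_if_differ_once:
  assumes G: "parcs G \<subseteq> pverts G \<times> pverts G"
    and xs: "xs \<in> words (pverts G) n" and ys: "ys \<in> words (pverts G) n"
    and i: "i < n" and adj: "(xs ! i, ys ! i) \<in> parcs G"
    and eq: "\<And>j. j < n \<Longrightarrow> j \<noteq> i \<Longrightarrow> xs ! j = ys ! j"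
  shows "(xs, ys) \<in> parcs (cart_power G n)"
proof -
  have l: "length xs = n" "length ys = n" using xs ys by (auto simp: words_def)
  have "xs = take i xs @ xs ! i # drop (Suc i) xs" using i l by (simp add: id_take_nth_drop)
  moreover have "take i ys = take i xs" "drop (Suc i) ys = drop (Suc i) xs"
    using i l eq by (auto intro!: nth_equalityI)
  then have "ys = take i xs @ ys ! i # drop (Suc i) xs"
    using i l by (metis id_take_nth_drop)
  moreover have "(take i xs, drop (Suc i) xs) \<in> lines (pverts G) n"
    using xs i l by (auto simp: lines_def words_def dest: in_set_takeD in_set_dropD)
  ultimately show ?thesis using adj unfolding parcs_cart_power[OF G] by blast
qed

section \<open>Ramsey's theorem with a finite set of colours\<close>

text \<open>
  The colours will be colour patterns of lines, so they form an arbitrary finite set here. Positivity of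
  \<open>R\<close> is what finally gives a positive exponent.
\<close>

lemma Ramsey_finite_colours:
  assumes "finite P"
  shows "\<exists>R>0. \<forall>f \<in> [{..<R::nat}]\<^bsup>k\<^esup> \<rightarrow> P. \<exists>T \<subseteq> {..<R}. card T = m \<and> (\<exists>\<chi>. \<forall>S \<in> [T]\<^bsup>k\<^esup>. f S = \<chi>)"
proof -
  obtain g where g: "bij_betw g P {..<card P}"
    using assms ex_bij_betw_finite_nat atLeast0LessThan by metis
  obtain R0 :: nat where "partn_lst {..<R0} (replicate (card P) m) k"
    using ramsey_full by blast
  then obtain R :: nat where "R > 0" and R: "partn_lst {..<R} (replicate (card P) m) k"
    using partn_lst_greater_resource[of R0 _ k "Suc R0"] by (metis le_SucI order_refl zero_less_Suc)
  show ?thesis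
  proof (intro exI[of _ R] conjI ballI)
    show "R > 0" by fact
    fix f assume f: "f \<in> [{..<R}]\<^bsup>k\<^esup> \<rightarrow> P"
    then have "g \<circ> f \<in> [{..<R}]\<^bsup>k\<^esup> \<rightarrow> {..<length (replicate (card P) m)}"
      using bij_betwE[OF g] by (fastforce simp: Pi_iff)
    with R obtain i T where i: "i < card P" and T: "T \<in> [{..<R}]\<^bsup>m\<^esup>" and mono: "(g \<circ> f) ` [T]\<^bsup>k\<^esup> \<subseteq> {i}"
      by (elim partn_lstE) (auto simp: monochromatic_def)
    have "f S = the_inv_into P g i" if "S \<in> [T]\<^bsup>k\<^esup>" for S
    proof -
      have "S \<in> [{..<R}]\<^bsup>k\<^esup>" using that T nsets_mono by (auto simp: nsets_def)
      with f have "f S \<in> P" by auto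
      then show ?thesis using mono that g by (auto simp: bij_betw_def the_inv_into_f_f)
    qed
    then show "\<exists>T \<subseteq> {..<R}. card T = m \<and> (\<exists>\<chi>. \<forall>S \<in> [T]\<^bsup>k\<^esup>. f S = \<chi>)"
      using T by (auto simp: nsets_def)
  qed
qed

section \<open>Spikes over a homogeneous set form attached layers\<close>

text \<open>
  The line of a \<open>k\<close>-set \<open>S\<close> of coordinates, evaluated at \<open>x\<close>. All ones precede the free coordinate, as for
  the edges of \<open>E\<^sup>*\<close>.
\<close>

definition spike :: "nat \<Rightarrow> 'a \<Rightarrow> 'a \<Rightarrow> nat set \<Rightarrow> 'a \<Rightarrow> 'a list" where
  "spike R a b S x = map (\<lambda>j. if j \<in> S then if j = Max S then x else a else b) [0..<R]"

lemma length_spike [simp]: "length (spike R a b S x) = R"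
  by (simp add: spike_def)

lemma nth_spike [simp]:
  "j < R \<Longrightarrow> spike R a b S x ! j = (if j \<in> S then if j = Max S then x else a else b)"
  by (simp add: spike_def)

lemma spike_in_words: "a \<in> V \<Longrightarrow> b \<in> V \<Longrightarrow> x \<in> V \<Longrightarrow> spike R a b S x \<in> words V R"
  by (auto simp: spike_def words_def)

lemma spike_support:
  assumes "S \<subseteq> {..<R}" "a \<noteq> b" "x \<noteq> b"
  shows "{j. j < R \<and> spike R a b S x ! j \<noteq> b} = S"
proof -
  have "j < R \<and> spike R a b S x ! j \<noteq> b \<longleftrightarrow> j \<in> S" for j
    using assms by (cases "j < R") auto
  then show ?thesis by blast
qed

text \<open>
  The free letter may equal \<open>a\<close>, but not \<open>b\<close>: then \<open>Max S\<close> would look like a coordinate outside \<open>S\<close>.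
\<close>

lemma spike_eq_iff:
  assumes "S \<subseteq> {..<R}" "S' \<subseteq> {..<R}" "S \<noteq> {}" "a \<noteq> b" "x \<noteq> b" "x' \<noteq> b"
  shows "spike R a b S x = spike R a b S' x' \<longleftrightarrow> S = S' \<and> x = x'"
proof
  assume eq: "spike R a b S x = spike R a b S' x'"
  then have S: "S = S'"
    using spike_support[of S R a b x] spike_support[of S' R a b x'] assms by simp
  have "finite S" using assms(1) finite_subset by blast
  then have M: "Max S \<in> S" using assms(3) by (rule Max_in)
  then have "Max S < R" using assms(1) by auto
  with M have "x = spike R a b S x ! Max S" "x' = spike R a b S x' ! Max S" by auto
  with eq S show "S = S' \<and> x = x'" by simp
qed auto

text \<open>
  The 0/1-word with set of ones \<open>S\<close> (letters \<open>a\<close> for one, \<open>b\<close> for zero) is the spike over \<open>S\<close> with free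
  letter \<open>a\<close>. It is also the spike with free letter \<open>b\<close> over any set that adds to \<open>S\<close> one coordinate
  beyond all of \<open>S\<close>. With an arbitrary late coordinate this turns the vertices of \<open>V\<^sub>k\<^sub>-\<^sub>1\<close> into spikes over
  \<open>k\<close>-sets; read backwards, for \<open>S\<close> a set without its maximum, it makes the copies of \<open>F\<close> fit onto the
  layers.
\<close>

lemma spike_last_base:
  "finite S \<Longrightarrow> (\<And>j. j \<in> S \<Longrightarrow> j < t) \<Longrightarrow> spike R a b (insert t S) b = spike R a b S a"
proof -
  assume S: "finite S" "\<And>j. j \<in> S \<Longrightarrow> j < t"
  then have "Max (insert t S) = t" by (intro Max_eqI) (auto intro: less_imp_le)
  moreover have "t \<notin> S" using S(2) by blast
  ultimately show ?thesis unfolding spike_def by auto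
qed

lemma spike_remove_Max: "spike R a b (S - {Max S}) a = spike R a b S b"
  unfolding spike_def by auto

lemma spike_line:
  assumes "S \<subseteq> {..<R}" "S \<noteq> {}" "a \<in> V" "b \<in> V"
  obtains p q where "(p, q) \<in> lines V R" "\<And>x. spike R a b S x = p @ x # q"
proof -
  have "finite S" using assms(1) finite_subset by blast
  then have M: "Max S \<in> S" using assms(2) by (rule Max_in)
  then have MR: "Max S < R" using assms(1) by auto
  let ?p = "take (Max S) (spike R a b S a)" and ?q = "drop (Suc (Max S)) (spike R a b S a)"
  have "spike R a b S x = ?p @ x # ?q" for x
    using MR M by (intro nth_equalityI) (auto simp: nth_append nth_Cons' )
  moreover have "(?p, ?q) \<in> lines V R"
    using assms spike_in_words[of a V b a R S] MR
    by (auto simp: lines_def words_def dest: in_set_takeD in_set_dropD)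
  ultimately show ?thesis using that by blast
qed

definition ones :: "bool list \<Rightarrow> nat set" where
  "ones u = {j. j < length u \<and> u ! j}"

lemma finite_ones [simp]: "finite (ones u)"
  by (simp add: ones_def)

lemma card_ones: "card (ones u) = count_list u True"
  by (simp add: ones_def count_list_eq_length_filter length_filter_conv_card)

lemma ones_inj: "length u = length v \<Longrightarrow> ones u = ones v \<Longrightarrow> u = v"
  by (rule nth_equalityI) (auto simp: ones_def set_eq_iff)

lemma layer_iff: "u \<in> layer m j \<longleftrightarrow> length u = m \<and> card (ones u) = j"
  by (auto simp: layer_def hypercube_def pverts_cart_power words_def K2_def card_ones)

lemma parcs_hypercube:
  "(u, v) \<in> parcs (hypercube m) \<longleftrightarrow>
    (\<exists>p q x. Suc (length p + length q) = m \<and> u = p @ x # q \<and> v = p @ (\<not> x) # q)"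
proof -
  have E: "(x, y) \<in> parcs K2 \<longleftrightarrow> y = (\<not> x)" for x y by (auto simp: K2_def)
  have V: "pverts K2 = UNIV" by (simp add: K2_def)
  show ?thesis
    unfolding hypercube_def parcs_cart_power[OF pair_graphD(2)[OF pair_graph_K2]] E V lines_def
    by simp
qed

text \<open>
  This is the property of \<open>E\<^sup>*\<close> on which the construction rests: the star of an edge in it is the last
  one of the upper end, so the free coordinate of a spike can serve as the star.
\<close>

lemma ones_star_edge:
  assumes "(u, v) \<in> star_edges k" "k \<ge> 1"
  shows "ones v = ones u - {Max (ones u)}"
proof -
  obtain p q x where u: "u = p @ x # q" and v: "v = p @ (\<not> x) # q"
    and c: "card (ones u) = k" "card (ones v) = k - 1"
    and star: "no_ones_after_star (edge_rep u v)"
    using assms by (auto simp: star_edges_def middle_layers_def induced_def parcs_hypercube layer_iff)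
  have x using u v c assms(2) by (cases x) (auto simp: card_ones)
  have q: "\<not> q ! j" if "j < length q" for j
  proof
    assume "q ! j"
    let ?w = "edge_rep u v"
    have "?w ! length p = None" "?w ! Suc (length p + j) = Some True"
      using u v \<open>q ! j\<close> that by (auto simp: edge_rep_def nth_append)
    with star that u v show False
      unfolding no_ones_after_star_def
      by (elim allE[of _ "length p"] allE[of _ "Suc (length p + j)"]) (auto simp: edge_rep_def)
  qed
  have last: "length p \<in> ones u" using u \<open>x\<close> by (simp add: ones_def)
  have "j \<le> length p" if "j \<in> ones u" for j
  proof (rule ccontr)
    assume "\<not> j \<le> length p"
    then obtain i where j: "j = Suc (length p + i)" using less_iff_Suc_add by (auto simp: not_le)
    have "j < length u" "u ! j" using that by (auto simp: ones_def)
    then have "i < length q" "q ! i" using u j by (auto simp: nth_append)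
    with q show False by blast
  qed
  then have "Max (ones u) = length p" using last by (intro Max_eqI) auto
  then show ?thesis using u v \<open>x\<close> by (auto simp: ones_def nth_append nth_Cons' split: if_splits)
qed

text \<open>
  The coordinates of \<open>L\<^sub>k\<close> are sent in increasing order to the first \<open>2k - 1\<close> elements of \<open>T\<close>. The
  vertex \<open>y\<close> of the copy of \<open>F\<close> along \<open>(u, v)\<close> goes to the spike over the ones of \<open>u\<close> with free letter
  \<open>\<phi> y\<close>; for \<open>y = a0\<close> and \<open>y = b0\<close> this agrees with the words of \<open>u\<close> and \<open>v\<close>. Only the description of
  the image by spikes is needed to control colours.
\<close>

lemma attached_layers_embed:
  fixes F :: "'f pair_pre_digraph" and G :: "'g pair_pre_digraph"
  assumes G: "pair_graph G" and F: "pair_graph F"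
    and k: "k \<ge> 1" and T: "T \<subseteq> {..<R}" "card T = 2 * k"
    and root: "(a0, b0) \<in> parcs F" and \<phi>: "embedding \<phi> F G"
  shows "\<exists>\<psi>. embedding \<psi> (attached_layers k F a0 b0) (cart_power G R) \<and>
    \<psi> ` pverts (attached_layers k F a0 b0)
      \<subseteq> {spike R (\<phi> a0) (\<phi> b0) S (\<phi> y) | S y. S \<in> [T]\<^bsup>k\<^esup> \<and> y \<in> pverts F}"
proof -
  define a b where "a = \<phi> a0" and "b = \<phi> b0"
  let ?A = "attached_layers k F a0 b0" and ?m = "2 * k - 1"
  note FG = pair_graphD[OF F] and GG = pair_graphD[OF G]
  have ab0: "a0 \<in> pverts F" "b0 \<in> pverts F" "a0 \<noteq> b0" using root FG(2,4) by (auto simp: irrefl_def)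
  have \<phi>_inj: "\<phi> x = \<phi> y \<longleftrightarrow> x = y" if "x \<in> pverts F" "y \<in> pverts F" for x y
    using \<phi> that by (auto simp: embedding_def inj_on_def)
  have \<phi>_V: "\<phi> x \<in> pverts G" if "x \<in> pverts F" for x
    using \<phi> that by (auto simp: embedding_def)
  have \<phi>_E: "(\<phi> x, \<phi> y) \<in> parcs G" if "(x, y) \<in> parcs F" for x y
    using \<phi> that by (auto simp: embedding_def)
  have ab: "a \<in> pverts G" "b \<in> pverts G" "a \<noteq> b" "(a, b) \<in> parcs G" "(b, a) \<in> parcs G"
    using ab0 \<phi>_inj \<phi>_V \<phi>_E[OF root] symD[OF GG(3) \<phi>_E[OF root]] by (simp_all add: a_def b_def)
  have finT: "finite T" using T(1) finite_subset by blast
  define pos where "pos j = sorted_list_of_set T ! j" for j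
  have lenT: "length (sorted_list_of_set T) = 2 * k" using T by simp
  have pos_less: "pos i < pos j" if "i < j" "j < 2 * k" for i j
    unfolding pos_def using lenT that
    by (intro sorted_wrt_nth_less[of "(<)" "sorted_list_of_set T"]) auto
  have pos_T: "pos j \<in> T" if "j < 2 * k" for j
    unfolding pos_def using lenT that finT by (metis nth_mem set_sorted_list_of_set)
  have pos_inj: "inj_on pos {..<2 * k}"
    using pos_less by (intro linorder_inj_onI) force+
  define place where "place u = pos ` ones u" for u
  have ones_le: "ones u \<subseteq> {..<?m}" if "length u = ?m" for u using that by (auto simp: ones_def)
  have ones_le': "ones u \<subseteq> {..<2 * k}" if "length u = ?m" for u using that by (auto simp: ones_def)
  have place_T: "place u \<subseteq> T" if "length u = ?m" for u
    using ones_le'[OF that] pos_T by (auto simp: place_def)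
  have card_place: "card (place u) = card (ones u)" if "length u = ?m" for u
    unfolding place_def using ones_le'[OF that] pos_inj by (meson card_image inj_on_subset)
  have fin_place: "finite (place u)" for u by (simp add: place_def)
  have place_inj: "u = v" if "place u = place v" "length u = ?m" "length v = ?m" for u v
    using that ones_le' inj_on_image_eq_iff[OF pos_inj, of "ones u" "ones v"]
    by (auto simp: place_def intro!: ones_inj)
  have place_star: "place v = place u - {Max (place u)}" and place_k: "place u \<in> [T]\<^bsup>k\<^esup>"
    and len_star: "length u = ?m" "length v = ?m"
    if uv: "(u, v) \<in> star_edges k" for u v
  proof -
    show len: "length u = ?m" "length v = ?m" using uv by (auto simp: star_edges_def layer_iff)
    have cu: "card (ones u) = k" using uv by (auto simp: star_edges_def layer_iff)
    then show "place u \<in> [T]\<^bsup>k\<^esup>" using len place_T card_place fin_place by (simp add: nsets_def)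
    have "ones u \<noteq> {}" using cu k by auto
    then have M: "Max (ones u) \<in> ones u" by simp
    then have M_less: "Max (ones u) < 2 * k" using ones_le'[OF len(1)] by blast
    have "Max (place u) = pos (Max (ones u))"
    proof (rule Max_eqI)
      fix y assume "y \<in> place u"
      then obtain j where j: "j \<in> ones u" "y = pos j" by (auto simp: place_def)
      then have "j \<le> Max (ones u)" by simp
      then consider "j = Max (ones u)" | "j < Max (ones u)" using le_neq_implies_less by blast
      then show "y \<le> pos (Max (ones u))"
        by cases (use j M_less pos_less[of j "Max (ones u)"] in \<open>simp_all add: less_imp_le\<close>)
    qed (use M in \<open>auto simp: place_def\<close>)
    moreover have "pos ` (ones u - {Max (ones u)}) = pos ` ones u - pos ` {Max (ones u)}"
      using M ones_le'[OF len(1)] by (intro inj_on_image_set_diff[OF pos_inj]) auto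
    ultimately show "place v = place u - {Max (place u)}"
      using ones_star_edge[OF uv k] by (simp add: place_def)
  qed
  define \<psi> where "\<psi> z = (case z of Inl u \<Rightarrow> spike R a b (place u) a
    | Inr (e, y) \<Rightarrow> spike R a b (place (fst e)) (\<phi> y))" for z :: "bool list + (bool list \<times> bool list) \<times> 'f"
  have \<psi>_attach: "\<psi> (attach a0 b0 e y) = spike R a b (place (fst e)) (\<phi> y)"
    if "e \<in> star_edges k" for e y
  proof -
    obtain u v where e: "e = (u, v)" by fastforce
    then show ?thesis using place_star[of u v] that spike_remove_Max[of R a b "place u"] ab0
      by (auto simp: \<psi>_def a_def[symmetric] b_def[symmetric])
  qed
  have vertsA: "pverts ?A = Inl ` (layer ?m (k - 1) \<union> layer ?m k)
    \<union> (\<Union>e\<in>star_edges k. attach a0 b0 e ` pverts F)"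
    by (auto simp: attached_layers_def graph_Union_def relabel_def middle_layers_def induced_def)
  have spike_k: "spike R a b S (\<phi> y) \<in> pverts (cart_power G R)" if "y \<in> pverts F" for S y
    using that ab \<phi>_V by (simp add: pverts_cart_power spike_in_words)
  have range_Inl: "\<exists>S y. \<psi> (Inl u) = spike R a b S (\<phi> y) \<and> S \<in> [T]\<^bsup>k\<^esup> \<and> y \<in> pverts F"
    if "u \<in> layer ?m (k - 1) \<union> layer ?m k" for u
  proof -
    have len: "length u = ?m" and c: "card (ones u) = k \<or> card (ones u) = k - 1"
      using that by (auto simp: layer_iff)
    have \<psi>u: "\<psi> (Inl u) = spike R a b (place u) a" by (simp add: \<psi>_def)
    from c show ?thesis
    proof
      assume "card (ones u) = k"
      then have "place u \<in> [T]\<^bsup>k\<^esup>" using len place_T card_place fin_place by (simp add: nsets_def)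
      with \<psi>u ab0 show ?thesis unfolding a_def by blast
    next
      assume c: "card (ones u) = k - 1"
      \<comment> \<open>The last element of \<open>T\<close> is no coordinate of \<open>L\<^sub>k\<close>; it completes \<open>place u\<close> to a \<open>k\<close>-set.\<close>
      let ?t = "pos ?m"
      have less: "j < ?t" if "j \<in> place u" for j
        using that ones_le[OF len] pos_less k by (auto simp: place_def)
      then have "?t \<notin> place u" by blast
      moreover have "?t \<in> T" using pos_T k by simp
      ultimately have "insert ?t (place u) \<in> [T]\<^bsup>k\<^esup>"
        using place_T[OF len] card_place[OF len] fin_place[of u] c k by (simp add: nsets_def)
      moreover have "\<psi> (Inl u) = spike R a b (insert ?t (place u)) (\<phi> b0)"
        using \<psi>u less fin_place spike_last_base[of "place u" ?t R a b] by (simp add: b_def)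
      ultimately show ?thesis using ab0 by blast
    qed
  qed
  have range: "\<psi> ` pverts ?A \<subseteq> {spike R a b S (\<phi> y) | S y. S \<in> [T]\<^bsup>k\<^esup> \<and> y \<in> pverts F}"
  proof (rule image_subsetI)
    fix z assume "z \<in> pverts ?A"
    then consider u where "z = Inl u" "u \<in> layer ?m (k - 1) \<union> layer ?m k"
      | e y where "z = attach a0 b0 e y" "e \<in> star_edges k" "y \<in> pverts F"
      unfolding vertsA by blast
    then show "\<psi> z \<in> {spike R a b S (\<phi> y) | S y. S \<in> [T]\<^bsup>k\<^esup> \<and> y \<in> pverts F}"
    proof cases
      case 1
      then show ?thesis using range_Inl by blast
    next
      case 2
      then have "place (fst e) \<in> [T]\<^bsup>k\<^esup>" using place_k[of "fst e" "snd e"] by simp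
      with 2 \<psi>_attach show ?thesis by blast
    qed
  qed
  have cases_A: "(\<exists>u. z = Inl u \<and> length u = ?m) \<or>
      (\<exists>u v y. z = Inr ((u, v), y) \<and> (u, v) \<in> star_edges k \<and> y \<in> pverts F \<and> y \<noteq> a0 \<and> y \<noteq> b0)"
    if "z \<in> pverts ?A" for z
    using that len_star unfolding vertsA by (fastforce simp: layer_iff split: if_splits)
  have place_R: "place u \<subseteq> {..<R}" if "length u = ?m" for u using place_T[OF that] T(1) by blast
  have place_ne: "place u \<noteq> {}" if "(u, v) \<in> star_edges k" for u v
    using place_k[OF that] k by (auto simp: nsets_def)
  \<comment> \<open>Words of the layers use only \<open>a\<close> and \<open>b\<close>, while \<open>\<phi> y\<close> is a third letter.\<close>
  have mixed: "spike R a b (place u) a \<noteq> spike R a b (place u') (\<phi> y)"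
    if "length u = ?m" "(u', v') \<in> star_edges k" "y \<in> pverts F" "y \<noteq> a0" "y \<noteq> b0" for u u' v' y
    using spike_eq_iff[OF place_R place_R place_ne, of u' u v' a b "\<phi> y" a] that ab0 \<phi>_inj ab(3) len_star
    by (metis a_def b_def)
  have "inj_on \<psi> (pverts ?A)"
  proof (rule inj_onI)
    fix z z' assume z: "z \<in> pverts ?A" "z' \<in> pverts ?A" and eq: "\<psi> z = \<psi> z'"
    from cases_A[OF z(1)] cases_A[OF z(2)] show "z = z'"
    proof (elim disjE exE conjE)
      fix u u' assume u: "z = Inl u" "length u = ?m" "z' = Inl u'" "length u' = ?m"
      have sub: "place u \<subseteq> {..<R}" "place u' \<subseteq> {..<R}" using place_R u by auto
      have e: "spike R a b (place u) a = spike R a b (place u') a"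
        using eq unfolding u(1,3) by (simp only: \<psi>_def sum.case)
      have "place u = place u'"
        using spike_support[OF sub(1) ab(3) ab(3)] spike_support[OF sub(2) ab(3) ab(3)]
        unfolding e by (rule trans[OF sym])
      then show ?thesis using place_inj u by blast
    next
      fix u u' v' y'
      assume "z = Inl u" "length u = ?m" "z' = Inr ((u', v'), y')" "(u', v') \<in> star_edges k"
        "y' \<in> pverts F" "y' \<noteq> a0" "y' \<noteq> b0"
      then show ?thesis using eq mixed[of u u' v' y'] by (simp add: \<psi>_def)
    next
      fix u u' v' y'
      assume "z' = Inl u" "length u = ?m" "z = Inr ((u', v'), y')" "(u', v') \<in> star_edges k"
        "y' \<in> pverts F" "y' \<noteq> a0" "y' \<noteq> b0"
      then show ?thesis using eq[symmetric] mixed[of u u' v' y'] by (simp add: \<psi>_def)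
    next
      fix u v y u' v' y'
      assume z: "z = Inr ((u, v), y)" "z' = Inr ((u', v'), y')"
        and e: "(u, v) \<in> star_edges k" "(u', v') \<in> star_edges k"
        and y: "y \<in> pverts F" "y \<noteq> b0" "y' \<in> pverts F" "y' \<noteq> b0"
      have "spike R a b (place u) (\<phi> y) = spike R a b (place u') (\<phi> y')"
        using eq z by (simp add: \<psi>_def)
      moreover have "\<phi> y \<noteq> b" "\<phi> y' \<noteq> b" using y \<phi>_inj ab0 by (auto simp: b_def)
      ultimately have "place u = place u'" "\<phi> y = \<phi> y'"
        using spike_eq_iff[OF place_R place_R place_ne[OF e(1)] ab(3)] len_star e by blast+
      then have "u = u'" "y = y'" using place_inj len_star e \<phi>_inj y by blast+
      moreover from \<open>u = u'\<close> have "v = v'"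
        using place_star[OF e(1)] place_star[OF e(2)] place_inj len_star e by metis
      ultimately show ?thesis using z by simp
    qed
  qed
  moreover have "\<psi> ` pverts ?A \<subseteq> pverts (cart_power G R)" 
    by (rule subset_trans[OF range]) (use spike_k in blast)
  moreover have "(\<psi> x, \<psi> y) \<in> parcs (cart_power G R)" if "(x, y) \<in> parcs ?A" for x y
  proof -
    from that consider (layers) u v where "x = Inl u" "y = Inl v" "(u, v) \<in> parcs (middle_layers k)"
      | (copy) e y1 y2 where "e \<in> star_edges k" "(y1, y2) \<in> parcs F"
          "x = attach a0 b0 e y1" "y = attach a0 b0 e y2"
      by (auto simp: attached_layers_def graph_Union_def relabel_def)
    then show ?thesis
    proof cases
      case layers
      then obtain p q w where pq: "Suc (length p + length q) = ?m" "u = p @ w # q" "v = p @ (\<not> w) # q"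
        by (auto simp: middle_layers_def induced_def parcs_hypercube)
      then have len: "length u = ?m" "length v = ?m" by auto
      have n: "length p < 2 * k" using pq by linarith
      have ones_uv: "j \<in> ones u \<longleftrightarrow> j \<in> ones v" if "j \<noteq> length p" for j
        using that pq by (auto simp: ones_def nth_append nth_Cons')
      have p_uv: "length p \<in> ones u \<longleftrightarrow> w" "length p \<in> ones v \<longleftrightarrow> \<not> w"
        using pq by (auto simp: ones_def)
      have pos_mem: "pos j \<in> place u' \<longleftrightarrow> j \<in> ones u'" if "j < 2 * k" "length u' = ?m" for j u'
        unfolding place_def using inj_on_image_mem_iff[OF pos_inj, of j "ones u'"] that ones_le' by auto
      have "spike R a b (place u) a ! j = spike R a b (place v) a ! j" if "j < R" "j \<noteq> pos (length p)" for j
      proof -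
        have "j \<in> place u \<longleftrightarrow> j \<in> place v" using that(2) ones_uv unfolding place_def image_iff by metis
        then show ?thesis using that by simp
      qed
      moreover have "pos (length p) < R" using pos_T n T by auto
      moreover from this have "(spike R a b (place u) a ! pos (length p), spike R a b (place v) a ! pos (length p)) \<in> parcs G"
        using pos_mem[OF n len(1)] pos_mem[OF n len(2)] p_uv ab by (cases w) simp_all
      ultimately show ?thesis
        using layers ab by (auto simp: \<psi>_def spike_in_words intro!: adjacent_if_differ_once[OF GG(2)])
    next
      case copy
      let ?S = "place (fst e)"
      have e: "(fst e, snd e) \<in> star_edges k" using copy by simp
      obtain p q where "(p, q) \<in> lines (pverts G) R" "\<And>x. spike R a b ?S x = p @ x # q"
        using spike_line[OF place_R place_ne[OF e] ab(1,2)] len_star[OF e] by metis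
      then show ?thesis unfolding copy(3,4) \<psi>_attach[OF copy(1)] parcs_cart_power[OF GG(2)]
        using \<phi>_E[OF copy(2)] by metis
    qed
  qed
  ultimately have "embedding \<psi> ?A (cart_power G R)" by (simp add: embedding_def)
  with range show ?thesis unfolding a_def b_def by blast
qed

section \<open>Subpowers that respect lines\<close>

text \<open>
  The embeddings of smaller powers that arise from fixing some coordinates. Mapping lines to lines is what
  transports both adjacency and the property of being pinned.
\<close>

definition line_map :: "'a set \<Rightarrow> nat \<Rightarrow> nat \<Rightarrow> ('a list \<Rightarrow> 'a list) \<Rightarrow> bool" where
  "line_map V N n \<iota> \<longleftrightarrow> \<iota> ` words V N \<subseteq> words V n \<and> inj_on \<iota> (words V N) \<and>
    (\<forall>p q. (p, q) \<in> lines V N \<longrightarrow>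
      (\<exists>p' q'. (p', q') \<in> lines V n \<and> (\<forall>x\<in>V. \<iota> (p @ x # q) = p' @ x # q')))"

lemma line_map_embedding:
  assumes "parcs G \<subseteq> pverts G \<times> pverts G" "line_map (pverts G) N n \<iota>"
  shows "embedding \<iota> (cart_power G N) (cart_power G n)"
proof -
  have "(\<iota> xs, \<iota> ys) \<in> parcs (cart_power G n)" if arc: "(xs, ys) \<in> parcs (cart_power G N)" for xs ys
  proof -
    obtain p q x y where 1: "(p, q) \<in> lines (pverts G) N" "(x, y) \<in> parcs G"
      "xs = p @ x # q" "ys = p @ y # q"
      using arc unfolding parcs_cart_power[OF assms(1)] by blast
    then obtain p' q' where "(p', q') \<in> lines (pverts G) n" "\<forall>x\<in>pverts G. \<iota> (p @ x # q) = p' @ x # q'"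
      using assms(2) unfolding line_map_def by blast
    moreover have "x \<in> pverts G" "y \<in> pverts G" using assms(1) 1(2) by auto
    ultimately show ?thesis unfolding parcs_cart_power[OF assms(1)] using 1 by blast
  qed
  with assms(2) show ?thesis by (auto simp: embedding_def line_map_def pverts_cart_power)
qed

lemma line_map_id: "line_map V N N id"
  by (auto simp: line_map_def)

lemma line_map_comp:
  assumes f: "line_map V l m f" and g: "line_map V m n g"
  shows "line_map V l n (\<lambda>v. g (f v))"
  unfolding line_map_def
proof (intro conjI allI impI)
  show "(\<lambda>v. g (f v)) ` words V l \<subseteq> words V n"
    using f g by (auto simp: line_map_def image_subset_iff)
  show "inj_on (\<lambda>v. g (f v)) (words V l)"
    using f g comp_inj_on[of f "words V l" g]
    by (auto simp: line_map_def comp_def intro: inj_on_subset)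
  fix p q assume "(p, q) \<in> lines V l"
  then obtain p' q' where "(p', q') \<in> lines V m" "\<forall>x\<in>V. f (p @ x # q) = p' @ x # q'"
    using f unfolding line_map_def by blast
  moreover from this obtain p'' q'' where "(p'', q'') \<in> lines V n" "\<forall>x\<in>V. g (p' @ x # q') = p'' @ x # q''"
    using g unfolding line_map_def by blast
  ultimately show "\<exists>p' q'. (p', q') \<in> lines V n \<and> (\<forall>x\<in>V. g (f (p @ x # q)) = p' @ x # q')"
    by auto
qed

lemma line_map_append_right:
  assumes "y' \<in> words V n'"
  shows "line_map V n (n + n') (\<lambda>y. y @ y')"
proof -
  have "(p, q @ y') \<in> lines V (n + n')" if "(p, q) \<in> lines V n" for p q
    using assms that by (auto simp: lines_def words_def)
  then show ?thesis using assms
    by (fastforce simp: line_map_def append_in_words inj_on_def)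
qed

lemma line_map_append_left:
  assumes "y' \<in> words V n'"
  shows "line_map V n (n' + n) (\<lambda>y. y' @ y)"
proof -
  have "(y' @ p, q) \<in> lines V (n' + n)" if "(p, q) \<in> lines V n" for p q
    using assms that by (auto simp: lines_def words_def)
  then show ?thesis using assms unfolding line_map_def
    by (force simp: append_in_words inj_on_def)
qed

lemma words_Suc: "v \<in> words V (Suc n) \<longleftrightarrow> (\<exists>x w. v = x # w \<and> x \<in> V \<and> w \<in> words V n)"
  by (auto simp: words_def length_Suc_conv)

text \<open>A line of a first block and a subpower of a second block make a subpower of one dimension more.\<close>

lemma line_map_Cons:
  assumes l: "(p1, q1) \<in> lines V m" and \<iota>: "line_map V N n \<iota>"
  shows "line_map V (Suc N) (m + n) (\<lambda>v. p1 @ hd v # q1 @ \<iota> (tl v))"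
  unfolding line_map_def
proof (intro conjI allI impI)
  have in_words: "p1 @ x # q1 @ y \<in> words V (m + n)" if "x \<in> V" "y \<in> words V n" for x y
    using append_in_words[OF point_in_words[OF l that(1)] that(2)] by simp
  show "(\<lambda>v. p1 @ hd v # q1 @ \<iota> (tl v)) ` words V (Suc N) \<subseteq> words V (m + n)"
    using \<iota> by (auto simp: words_Suc line_map_def image_subset_iff intro!: in_words)
  show "inj_on (\<lambda>v. p1 @ hd v # q1 @ \<iota> (tl v)) (words V (Suc N))"
    using \<iota> by (auto simp: words_Suc line_map_def inj_on_def)
  fix p q assume pq: "(p, q) \<in> lines V (Suc N)"
  show "\<exists>p' q'. (p', q') \<in> lines V (m + n) \<and>
    (\<forall>x\<in>V. p1 @ hd (p @ x # q) # q1 @ \<iota> (tl (p @ x # q)) = p' @ x # q')"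
  proof (cases p)
    case Nil
    then have "q \<in> words V N" using pq by (auto simp: lines_def words_def)
    then have "\<iota> q \<in> words V n" using \<iota> by (auto simp: line_map_def)
    with l Nil show ?thesis
      by (intro exI[of _ p1] exI[of _ "q1 @ \<iota> q"]) (auto simp: lines_def words_def)
  next
    case (Cons x0 p0)
    then have "(p0, q) \<in> lines V N" "x0 \<in> V" using pq by (auto simp: lines_def)
    then obtain p' q' where "(p', q') \<in> lines V n" "\<forall>x\<in>V. \<iota> (p0 @ x # q) = p' @ x # q'"
      using \<iota> unfolding line_map_def by blast
    with l Cons \<open>x0 \<in> V\<close> show ?thesis
      by (intro exI[of _ "p1 @ x0 # q1 @ p'"] exI[of _ q']) (auto simp: lines_def)
  qed
qed

section \<open>Excluding arcs one by one\<close>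

locale rooted_ramsey =
  fixes r k :: nat and G :: "'g pair_pre_digraph"
    and I :: "'i set" and F :: "'i \<Rightarrow> 'f pair_pre_digraph" and a b :: "'i \<Rightarrow> 'f"
    and H :: "'h pair_pre_digraph"
  assumes G: "pair_graph G"
    and F: "i \<in> I \<Longrightarrow> pair_graph (F i)"
    and root: "i \<in> I \<Longrightarrow> (a i, b i) \<in> parcs (F i)"
    and host: "arrows G r (F ` I)"
    and H: "pair_graph H"
    and k: "k \<ge> 1"
    and copy: "i \<in> I \<Longrightarrow> contains_copy (attached_layers k (F i) (a i) (b i)) H"
begin

abbreviation V :: "'g set" where "V \<equiv> pverts G"

lemma arcs_G: "parcs G \<subseteq> V \<times> V" and finite_V: "finite V"
  using pair_graphD[OF G] by auto

text \<open>The pattern \<open>\<chi>\<close> is that of the colours along a line, which is identified with \<open>G\<close>.\<close>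

definition pinned :: "('g \<Rightarrow> nat) \<Rightarrow> 'g \<times> 'g \<Rightarrow> bool" where
  "pinned \<chi> e \<longleftrightarrow> (\<exists>i\<in>I. \<exists>\<phi>. embedding \<phi> (F i) G \<and> (\<phi> (a i), \<phi> (b i)) = e \<and>
    (\<exists>j. \<forall>y\<in>pverts (F i). \<chi> (\<phi> y) = j))"

lemma pinned_cong:
  "(\<And>x. x \<in> V \<Longrightarrow> \<chi> x = \<chi>' x) \<Longrightarrow> e = e' \<Longrightarrow> pinned \<chi> e \<longleftrightarrow> pinned \<chi>' e'"
  unfolding pinned_def embedding_def by (metis (no_types, lifting) image_subset_iff)

definition mono_copy :: "nat \<Rightarrow> ('g list \<Rightarrow> nat) \<Rightarrow> bool" where
  "mono_copy n c \<longleftrightarrow> (\<exists>h. embedding h H (cart_power G n) \<and> (\<exists>j. \<forall>x\<in>pverts H. c (h x) = j))"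

lemma mono_copy_line_map:
  assumes "line_map V N n \<iota>" "mono_copy N (\<lambda>y. c (\<iota> y))"
  shows "mono_copy n c"
  using assms embedding_comp[OF _ line_map_embedding[OF arcs_G assms(1)]]
  unfolding mono_copy_def by fastforce

text \<open>
  The Ramsey alternative in which \<open>H\<close> appears: the copy of \<open>F i\<close> that pins the common pattern has one
  colour, and the spikes of \<open>attached_layers_embed\<close> repeat that colour on every line over \<open>T\<close>.
\<close>

lemma pinned_spikes_mono_copy:
  assumes T: "T \<subseteq> {..<R}" "card T = 2 * k"
    and const: "\<And>S x. S \<in> [T]\<^bsup>k\<^esup> \<Longrightarrow> x \<in> V \<Longrightarrow> c (spike R u v S x) = \<chi> x"
    and pin: "pinned \<chi> (u, v)"
  shows "mono_copy R c"
proof -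
  obtain i \<phi> j where i: "i \<in> I" and \<phi>: "embedding \<phi> (F i) G"
    and uv: "\<phi> (a i) = u" "\<phi> (b i) = v" and j: "\<forall>y\<in>pverts (F i). \<chi> (\<phi> y) = j"
    using pin by (auto simp: pinned_def)
  let ?A = "attached_layers k (F i) (a i) (b i)"
  obtain \<psi> where \<psi>: "embedding \<psi> ?A (cart_power G R)"
    and range: "\<psi> ` pverts ?A \<subseteq> {spike R u v S (\<phi> y) | S y. S \<in> [T]\<^bsup>k\<^esup> \<and> y \<in> pverts (F i)}"
    using attached_layers_embed[OF G F[OF i] k T root[OF i] \<phi>] uv by auto
  obtain h where h: "embedding h H ?A"
    using copy[OF i] contains_copy_iff[OF H pair_graph_attached_layers[OF F[OF i]]] by blast
  have "c (\<psi> z) = j" if "z \<in> pverts ?A" for z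
  proof -
    have "\<psi> z \<in> {spike R u v S (\<phi> y) | S y. S \<in> [T]\<^bsup>k\<^esup> \<and> y \<in> pverts (F i)}"
      using range that by blast
    then obtain S y where "\<psi> z = spike R u v S (\<phi> y)" "S \<in> [T]\<^bsup>k\<^esup>" "y \<in> pverts (F i)" by blast
    then show ?thesis using const j \<phi> by (auto simp: embedding_def)
  qed
  then have "\<forall>x\<in>pverts H. c ((\<psi> \<circ> h) x) = j" using h by (auto simp: embedding_def)
  with embedding_comp[OF h \<psi>] show ?thesis unfolding mono_copy_def by blast
qed

text \<open>
  The second argument \<open>w\<close> of the colouring is the \<^emph>\<open>context\<close>: the letters on the \<open>m\<close> coordinates of the
  other blocks. The subpower must avoid \<open>E\<close> in all contexts simultaneously, since the other
  blocks are still going to change.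
\<close>

definition avoids :: "('g \<times> 'g) set \<Rightarrow> nat \<Rightarrow> nat \<Rightarrow> nat \<Rightarrow> bool" where
  "avoids E m N n \<longleftrightarrow> (\<forall>c.
    (\<forall>y\<in>words V n. \<forall>w\<in>words V m. c y w \<in> {1..r}) \<longrightarrow>
    (\<exists>w\<in>words V m. mono_copy n (\<lambda>y. c y w)) \<or>
    (\<exists>\<iota>. line_map V N n \<iota> \<and> (\<forall>p q. (p, q) \<in> lines V N \<longrightarrow>
      (\<forall>w\<in>words V m. \<forall>e\<in>E. \<not> pinned (\<lambda>x. c (\<iota> (p @ x # q)) w) e))))"

lemma avoidsD:
  assumes "avoids E m N n"
    and "\<And>y w. y \<in> words V n \<Longrightarrow> w \<in> words V m \<Longrightarrow> c y w \<in> {1..r}"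
    and "\<And>w. w \<in> words V m \<Longrightarrow> \<not> mono_copy n (\<lambda>y. c y w)"
  obtains \<iota> where "line_map V N n \<iota>"
    and "\<And>p q w e. (p, q) \<in> lines V N \<Longrightarrow> w \<in> words V m \<Longrightarrow> e \<in> E \<Longrightarrow>
      \<not> pinned (\<lambda>x. c (\<iota> (p @ x # q)) w) e"
proof -
  have "\<exists>\<iota>. line_map V N n \<iota> \<and> (\<forall>p q. (p, q) \<in> lines V N \<longrightarrow>
      (\<forall>w\<in>words V m. \<forall>e\<in>E. \<not> pinned (\<lambda>x. c (\<iota> (p @ x # q)) w) e))"
    using assms(1)[unfolded avoids_def, rule_format, of c] assms(2,3) by blast
  then show ?thesis using that by blast
qed

lemma avoidsI:
  assumes "\<And>c. (\<And>y w. y \<in> words V n \<Longrightarrow> w \<in> words V m \<Longrightarrow> c y w \<in> {1..r}) \<Longrightarrow>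
    (\<And>w. w \<in> words V m \<Longrightarrow> \<not> mono_copy n (\<lambda>y. c y w)) \<Longrightarrow>
    \<exists>\<iota>. line_map V N n \<iota> \<and> (\<forall>p q. (p, q) \<in> lines V N \<longrightarrow>
      (\<forall>w\<in>words V m. \<forall>e\<in>E. \<not> pinned (\<lambda>x. c (\<iota> (p @ x # q)) w) e))"
  shows "avoids E m N n"
  unfolding avoids_def by (intro allI impI, subst disj_imp, rule impI, rule assms) blast+

definition avoidable :: "('g \<times> 'g) set \<Rightarrow> bool" where
  "avoidable E \<longleftrightarrow> (\<forall>m N. \<exists>n\<ge>N. avoids E m N n)"

lemma avoidable_empty: "avoidable {}"
  unfolding avoidable_def avoids_def using line_map_id by blast

text \<open>
  The Ramsey step. It runs inside a subpower of dimension \<open>R\<close> whose lines avoid \<open>E\<close>, so that whichever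
  spike line is chosen, \<open>E\<close> stays excluded. A pattern records the colours in all contexts; therefore one spike
  line avoids \<open>(u, v)\<close> in every context, or some context contains \<open>H\<close>.
\<close>

lemma line_avoiding_insert:
  assumes E: "avoidable E" and uv: "(u, v) \<in> parcs G"
  shows "\<exists>n>0. avoids (insert (u, v) E) m 1 n"
proof -
  have uv_V: "u \<in> V" "v \<in> V" using arcs_G uv by auto
  let ?D = "V \<times> words V m"
  have "finite (?D \<rightarrow>\<^sub>E {1..r})"
    by (intro finite_PiE finite_cartesian_product finite_V finite_words) auto
  then obtain R :: nat where "R > 0" and R: "\<forall>f \<in> [{..<R}]\<^bsup>k\<^esup> \<rightarrow> (?D \<rightarrow>\<^sub>E {1..r}).
      \<exists>T \<subseteq> {..<R}. card T = 2 * k \<and> (\<exists>\<chi>. \<forall>S \<in> [T]\<^bsup>k\<^esup>. f S = \<chi>)"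
    using Ramsey_finite_colours[of "?D \<rightarrow>\<^sub>E {1..r}" k "2 * k"] by blast
  obtain n where "n \<ge> R" and n: "avoids E m R n"
    using E unfolding avoidable_def by blast
  have "avoids (insert (u, v) E) m 1 n"
  proof (rule avoidsI)
    fix c assume c: "\<And>y w. y \<in> words V n \<Longrightarrow> w \<in> words V m \<Longrightarrow> c y w \<in> {1..r}"
      and no_copy: "\<And>w. w \<in> words V m \<Longrightarrow> \<not> mono_copy n (\<lambda>y. c y w)"
    obtain \<iota> where \<iota>: "line_map V R n \<iota>"
      and avoid: "\<And>p q w e. (p, q) \<in> lines V R \<Longrightarrow> w \<in> words V m \<Longrightarrow> e \<in> E \<Longrightarrow>
        \<not> pinned (\<lambda>x. c (\<iota> (p @ x # q)) w) e"
      using avoidsD[OF n, of c] c no_copy by blast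
    define f where "f S = restrict (\<lambda>(x, w). c (\<iota> (spike R u v S x)) w) ?D" for S
    have "\<iota> (spike R u v S x) \<in> words V n" if "x \<in> V" for S x
      using \<iota> spike_in_words[OF uv_V that, of R S] by (auto simp: line_map_def)
    then have "f S \<in> ?D \<rightarrow>\<^sub>E {1..r}" for S
      unfolding f_def using c by (intro restrict_PiE_iff[THEN iffD2]) (auto simp del: atLeastAtMost_iff)
    then have "f \<in> [{..<R}]\<^bsup>k\<^esup> \<rightarrow> (?D \<rightarrow>\<^sub>E {1..r})" by blast
    then obtain T \<chi> where T: "T \<subseteq> {..<R}" "card T = 2 * k" and \<chi>: "\<And>S. S \<in> [T]\<^bsup>k\<^esup> \<Longrightarrow> f S = \<chi>"
      using bspec[OF R, of f] by blast
    have c_\<chi>: "c (\<iota> (spike R u v S x)) w = \<chi> (x, w)"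
      if "S \<in> [T]\<^bsup>k\<^esup>" "x \<in> V" "w \<in> words V m" for S x w
      using that \<chi>[of S] by (auto simp: f_def)
    obtain S where S: "S \<subseteq> T" "card S = k"
      using T(2) by (metis obtain_subset_with_card_n le_add1 mult_2)
    have "finite T" using T(1) finite_subset by blast
    then have S': "S \<in> [T]\<^bsup>k\<^esup>" using S by (auto simp: nsets_def intro: finite_subset)
    have "S \<noteq> {}" "S \<subseteq> {..<R}" using S k T(1) by auto
    then obtain p q where pq: "(p, q) \<in> lines V R" "\<And>x. spike R u v S x = p @ x # q"
      using spike_line[of S R u V v] uv_V by metis
    have "\<not> pinned (\<lambda>x. c (\<iota> (p @ x # q)) w) (u, v)" if w: "w \<in> words V m" for w
    proof
      assume pin: "pinned (\<lambda>x. c (\<iota> (p @ x # q)) w) (u, v)"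
      have "c (\<iota> (spike R u v S' x)) w = c (\<iota> (p @ x # q)) w" if "S' \<in> [T]\<^bsup>k\<^esup>" "x \<in> V" for S' x
        using c_\<chi>[OF that w] c_\<chi>[OF S' that(2) w] pq(2) by simp
      then have "mono_copy R (\<lambda>y. c (\<iota> y) w)"
        by (rule pinned_spikes_mono_copy[OF T _ pin])
      then have "mono_copy n (\<lambda>y. c y w)" by (rule mono_copy_line_map[OF \<iota>])
      with no_copy w show False by blast
    qed
    with avoid[OF pq(1)] have "\<not> pinned (\<lambda>x. c (\<iota> (p @ x # q)) w) e"
      if "w \<in> words V m" "e \<in> insert (u, v) E" for w e
      using that by blast
    moreover have "line_map V 1 R (\<lambda>v. p @ hd v # q @ id (tl v))"
      using line_map_Cons[OF pq(1) line_map_id[of V 0]] by simp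
    then have "line_map V 1 n (\<lambda>v. \<iota> (p @ hd v # q @ id (tl v)))"
      by (rule line_map_comp[OF _ \<iota>])
    ultimately show "\<exists>\<iota>. line_map V 1 n \<iota> \<and> (\<forall>p q. (p, q) \<in> lines V 1 \<longrightarrow>
        (\<forall>w\<in>words V m. \<forall>e\<in>insert (u, v) E. \<not> pinned (\<lambda>x. c (\<iota> (p @ x # q)) w) e))"
      by (intro exI[of _ "\<lambda>v. \<iota> (p @ hd v # q @ id (tl v))"]) (auto simp: lines_def)
  qed
  moreover have "n > 0" using \<open>R > 0\<close> \<open>n \<ge> R\<close> by simp
  ultimately show ?thesis by blast
qed

text \<open>
  The blocks are treated in two stages. The first block, of \<open>n1\<close> coordinates, is shrunk to a line while the
  \<open>n'\<close> later coordinates still belong to the context. Its single free letter then becomes the first letter of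
  the context for the second stage. A line of the resulting subpower moves either in
  the first coordinate, where the first stage excludes \<open>E\<close>, or in a later one, where the second stage does.
\<close>

lemma avoids_Suc:
  assumes n1: "avoids E (n' + m) 1 n1" and n': "avoids E (Suc m) N n'"
  shows "avoids E m (Suc N) (n1 + n')"
proof (rule avoidsI)
  fix c assume c: "\<And>y w. y \<in> words V (n1 + n') \<Longrightarrow> w \<in> words V m \<Longrightarrow> c y w \<in> {1..r}"
    and no_copy: "\<And>w. w \<in> words V m \<Longrightarrow> \<not> mono_copy (n1 + n') (\<lambda>y. c y w)"
  \<comment> \<open>Colouring of the first block; the context lists the second block before \<open>w\<close>.\<close>
  define c1 where "c1 y z = c (y @ take n' z) (drop n' z)" for y z
  have split: "take n' z \<in> words V n'" "drop n' z \<in> words V m" if "z \<in> words V (n' + m)" for z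
    using that by (auto simp: words_def dest: in_set_takeD in_set_dropD)
  have c1_eq: "c1 y (y' @ w) = c (y @ y') w" if "y' \<in> words V n'" for y y' w
    using that by (simp add: c1_def words_def)
  have "c1 y z \<in> {1..r}" if "y \<in> words V n1" "z \<in> words V (n' + m)" for y z
    unfolding c1_def using c append_in_words split that by blast
  moreover have "\<not> mono_copy n1 (\<lambda>y. c1 y z)" if "z \<in> words V (n' + m)" for z
    unfolding c1_def
    using split[OF that] no_copy mono_copy_line_map[OF line_map_append_right[of "take n' z" V n' n1],
      where c = "\<lambda>y. c y (drop n' z)"] by blast
  ultimately obtain \<iota>1 where \<iota>1: "line_map V 1 n1 \<iota>1"
    and avoid1: "\<And>p q z e. (p, q) \<in> lines V 1 \<Longrightarrow> z \<in> words V (n' + m) \<Longrightarrow> e \<in> E \<Longrightarrow>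
      \<not> pinned (\<lambda>x. c1 (\<iota>1 (p @ x # q)) z) e"
    using avoidsD[OF n1, of c1] by blast
  have nil_line: "([], []) \<in> lines V 1" by (simp add: lines_def)
  then obtain p1 q1 where l1: "(p1, q1) \<in> lines V n1" and \<iota>1_eq: "\<And>x. x \<in> V \<Longrightarrow> \<iota>1 [x] = p1 @ x # q1"
    using \<iota>1 unfolding line_map_def by (metis append_Nil)
  \<comment> \<open>Colouring of the second block; the context starts with the letter left free by the first stage.\<close>
  define c2 where "c2 y' z = c (p1 @ hd z # q1 @ y') (tl z)" for y' z
  have point: "p1 @ x # q1 @ y' \<in> words V (n1 + n')" if "x \<in> V" "y' \<in> words V n'" for x y'
    using append_in_words[OF point_in_words[OF l1 that(1)] that(2)] by simp
  have "c2 y z \<in> {1..r}" if "y \<in> words V n'" "z \<in> words V (Suc m)" for y z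
    using c point that by (auto simp: c2_def words_Suc simp del: atLeastAtMost_iff)
  moreover have "\<not> mono_copy n' (\<lambda>y. c2 y z)" if z_word: "z \<in> words V (Suc m)" for z
  proof
    assume mono: "mono_copy n' (\<lambda>y. c2 y z)"
    obtain x w where z: "z = x # w" "x \<in> V" "w \<in> words V m" using z_word by (auto simp: words_Suc)
    have "mono_copy (n1 + n') (\<lambda>y. c y w)"
      using mono_copy_line_map[OF line_map_append_left[OF point_in_words[OF l1 z(2)], of n'],
        where c = "\<lambda>y. c y w"] mono z(1) by (simp add: c2_def)
    with no_copy z(3) show False by blast
  qed
  ultimately obtain \<iota> where \<iota>: "line_map V N n' \<iota>"
    and avoid2: "\<And>p q z e. (p, q) \<in> lines V N \<Longrightarrow> z \<in> words V (Suc m) \<Longrightarrow> e \<in> E \<Longrightarrow>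
      \<not> pinned (\<lambda>x. c2 (\<iota> (p @ x # q)) z) e"
    using avoidsD[OF n', of c2] by blast
  let ?\<iota> = "\<lambda>v. p1 @ hd v # q1 @ \<iota> (tl v)"
  have "\<not> pinned (\<lambda>x. c (?\<iota> (p @ x # q)) w) e"
    if pq: "(p, q) \<in> lines V (Suc N)" and w: "w \<in> words V m" and e: "e \<in> E" for p q w e
  proof (cases p)
    case Nil
    then have "q \<in> words V N" using pq by (auto simp: lines_def words_def)
    then have \<iota>q: "\<iota> q \<in> words V n'" using \<iota> by (auto simp: line_map_def)
    have "\<not> pinned (\<lambda>x. c1 (\<iota>1 [x]) (\<iota> q @ w)) e"
      using avoid1[OF nil_line append_in_words[OF \<iota>q w] e] by simp
    moreover have "c1 (\<iota>1 [x]) (\<iota> q @ w) = c (?\<iota> (p @ x # q)) w" if "x \<in> V" for x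
      using Nil \<iota>1_eq[OF that] c1_eq[OF \<iota>q] by simp
    ultimately show ?thesis by (simp cong: pinned_cong)
  next
    case (Cons x0 p0)
    then have "(p0, q) \<in> lines V N" "x0 # w \<in> words V (Suc m)"
      using pq w by (auto simp: lines_def words_Suc)
    then show ?thesis using avoid2[of p0 q "x0 # w" e] e Cons by (simp add: c2_def)
  qed
  with line_map_Cons[OF l1 \<iota>] show "\<exists>\<iota>. line_map V (Suc N) (n1 + n') \<iota> \<and>
    (\<forall>p q. (p, q) \<in> lines V (Suc N) \<longrightarrow>
      (\<forall>w\<in>words V m. \<forall>e\<in>E. \<not> pinned (\<lambda>x. c (\<iota> (p @ x # q)) w) e))"
    by blast
qed

text \<open>
  \<open>n'\<close> is chosen before \<open>n1\<close>: the earlier block has to be large compared with the number of contents of the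
  later ones. The context grows by one letter in each step, so the induction is over all \<open>m\<close>.
\<close>

lemma avoidable_insert:
  assumes "avoidable E" and "(u, v) \<in> parcs G"
  shows "avoidable (insert (u, v) E)"
proof -
  let ?E = "insert (u, v) E"
  have "\<exists>n\<ge>N. avoids ?E m N n" for N m
  proof (induction N arbitrary: m)
    case 0
    have "avoids ?E m 0 0"
      unfolding avoids_def using line_map_id[of V 0] by (auto simp: lines_def)
    then show ?case by blast
  next
    case (Suc N)
    obtain n' where "n' \<ge> N" and n': "avoids ?E (Suc m) N n'"
      using Suc by blast
    obtain n1 where "n1 > 0" and n1: "avoids ?E (n' + m) 1 n1"
      using line_avoiding_insert[OF assms, of "n' + m"] by blast
    have "Suc N \<le> n1 + n'" using \<open>n1 > 0\<close> \<open>n' \<ge> N\<close> by simp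
    with avoids_Suc[OF n1 n'] show ?case by blast
  qed
  then show ?thesis unfolding avoidable_def by blast
qed

lemma avoidable_parcs: "avoidable (parcs G)"
proof -
  have "finite (parcs G)"
    using arcs_G finite_V by (meson finite_SigmaI finite_subset)
  moreover have "avoidable E" if "finite E" "E \<subseteq> parcs G" for E
    using that by (induction E rule: finite_induct) (auto intro: avoidable_empty avoidable_insert)
  ultimately show ?thesis by blast
qed

text \<open>The arrow hypothesis forbids avoiding all arcs, even on a single line.\<close>

lemma some_arc_pinned:
  assumes "\<And>x. x \<in> V \<Longrightarrow> \<chi> x \<in> {1..r}"
  shows "\<exists>e\<in>parcs G. pinned \<chi> e"
proof -
  have "\<And>H. H \<in> F ` I \<Longrightarrow> pair_graph H" using F by auto
  then have "\<exists>i\<in>I. \<exists>\<phi>. embedding \<phi> (F i) G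
      \<and> (\<forall>x\<in>pverts (F i). \<forall>y\<in>pverts (F i). \<chi> (\<phi> x) = \<chi> (\<phi> y))"
    using host assms by (simp add: arrows_iff G image_subset_iff)
  then obtain i \<phi> where i: "i \<in> I" and \<phi>: "embedding \<phi> (F i) G"
    and mono: "\<forall>x\<in>pverts (F i). \<forall>y\<in>pverts (F i). \<chi> (\<phi> x) = \<chi> (\<phi> y)"
    by blast
  have "a i \<in> pverts (F i)" using root[OF i] pair_graphD(2)[OF F[OF i]] by auto
  with mono have "\<forall>y\<in>pverts (F i). \<chi> (\<phi> y) = \<chi> (\<phi> (a i))" by blast
  moreover have "(\<phi> (a i), \<phi> (b i)) \<in> parcs G" using \<phi> root[OF i] by (auto simp: embedding_def)
  ultimately show ?thesis using i \<phi> unfolding pinned_def by blast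
qed

lemma power_arrows: "\<exists>n\<ge>1. arrows (cart_power G n) r {H}"
proof -
  obtain n where "n \<ge> 1" and n: "avoids (parcs G) 0 1 n"
    using avoidable_parcs unfolding avoidable_def by blast
  have "mono_copy n c" if c: "c ` words V n \<subseteq> {1..r}" for c
  proof (rule ccontr)
    assume "\<not> mono_copy n c"
    then obtain \<iota> where \<iota>: "line_map V 1 n \<iota>"
      and avoid: "\<And>p q w e. (p, q) \<in> lines V 1 \<Longrightarrow> w \<in> words V 0 \<Longrightarrow> e \<in> parcs G \<Longrightarrow>
        \<not> pinned (\<lambda>x. c (\<iota> (p @ x # q))) e"
      using avoidsD[OF n, of "\<lambda>y _. c y"] c by blast
    have avoid_id: "\<not> pinned (\<lambda>x. c (\<iota> [x])) e" if "e \<in> parcs G" for e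
      using avoid[of "[]" "[]" "[]" e] that by (simp add: lines_def words_def)
    have "c (\<iota> [x]) \<in> {1..r}" if "x \<in> V" for x
    proof -
      have "[x] \<in> words V 1" using that by (simp add: words_def)
      then have "\<iota> [x] \<in> words V n" using \<iota> unfolding line_map_def by blast
      with c show ?thesis by blast
    qed
    with some_arc_pinned[of "\<lambda>x. c (\<iota> [x])"] avoid_id show False by blast
  qed
  then have "\<exists>h. embedding h H (cart_power G n) \<and> (\<forall>x\<in>pverts H. \<forall>y\<in>pverts H. c (h x) = c (h y))"
    if "c ` words V n \<subseteq> {1..r}" for c
    using that unfolding mono_copy_def by metis
  then have "arrows (cart_power G n) r {H}"
    using arrows_iff[of "{H}", OF _ pair_graph_cart_power[OF G]] H by (simp add: pverts_cart_power)
  with \<open>n \<ge> 1\<close> show ?thesis by blast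
qed

end

theorem theorem3:
  fixes r s :: nat
    and G :: "'g pair_pre_digraph"
    and F :: "nat \<Rightarrow> 'f pair_pre_digraph"
    and H :: "'h pair_pre_digraph"
    and a b :: "nat \<Rightarrow> 'f"
  assumes "r \<ge> 1" and "s \<ge> 1"
    and "pair_graph G"
    and "\<And>i. i \<in> {1..s} \<Longrightarrow> pair_graph (F i)"
    and "arrows G r (F ` {1..s})"
    and "pair_graph H"
    and "\<And>i. i \<in> {1..s} \<Longrightarrow> (a i, b i) \<in> parcs (F i)"
    and "\<exists>k\<ge>1. \<forall>i\<in>{1..s}. contains_copy (attached_layers k (F i) (a i) (b i)) H"
  shows "\<exists>n\<ge>1. arrows (cart_power G n) r {H}"
proof -
  obtain k where k: "k \<ge> 1"
    and copy: "\<And>i. i \<in> {1..s} \<Longrightarrow> contains_copy (attached_layers k (F i) (a i) (b i)) H"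
    using assms(8) by blast
  show ?thesis
    by (rule rooted_ramsey.power_arrows, rule rooted_ramsey.intro)
      (fact assms(3) assms(4) assms(7) assms(5) assms(6) k copy)+
qed

end
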